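(* Let $K:(0,\infty)\to\mathbb{R}$ be $C^1$ and strictly decreasing with $\int_0^1 K(r)\,r\,dr<\infty$, and let $D(\Omega)=\int_\Omega\int_\Omega K(|x-y|)\,dx\,dy$. Let $O$ be the origin and let $\Omega=\triangle_{ABC}\subset\mathbb{R}^2$ be a non-obtuse triangle with $AB$ being the shortest side and lying on the $x$-axis, and with $C$ lying on the positive $y$-axis. Suppose $|AB|<|BC|\le|AC|$. For $t<1$ let $C_t=(1-t)C$ and $\Omega_t=\sqrt{|OC|/|OC_t|}\,\triangle_{ABC_t}$ (the image of the triangle $\triangle_{ABC_t}$ under the dilation centred at $O$ with factor $\sqrt{|OC|/|OC_t|}$). Let $t_2\in(0,1)$ be the unique number in $(0,1)$ such that $|BA|=|BC_{t_2}|$. Then $t\mapsto D(\Omega_t)$ is a strictly increasing function on $(-\infty,t_2)$.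
   Context: $\triangle_{ABC}$ denotes the triangular region with vertices $A,B,C$, and $|PQ|$ the length of the segment $PQ$. The condition $\int_0^1K(r)r\,dr<\infty$ guarantees that $D$ is finite on bounded planar domains. *)

theory Defs
  imports "HOL-Analysis.Analysis"
begin

definition interaction :: "(real \<Rightarrow> real) \<Rightarrow> (real ^ 2) set \<Rightarrow> real" where
  "interaction K \<Omega> = (LINT x:\<Omega>|lborel. (LINT y:\<Omega>|lborel. K (norm (x - y))))"

definition triangle_region :: "real ^ 2 \<Rightarrow> real ^ 2 \<Rightarrow> real ^ 2 \<Rightarrow> (real ^ 2) set" where
  "triangle_region A B C = convex hull {A, B, C}"

text \<open>The unoriented angle, in [0, pi], at the vertex Q between the rays QP and QR;
  meaningful only if Q differs from both P and R.\<close>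
definition vertex_angle :: "real ^ 2 \<Rightarrow> real ^ 2 \<Rightarrow> real ^ 2 \<Rightarrow> real" where
  "vertex_angle P Q R = arccos (((P - Q) \<bullet> (R - Q)) / (norm (P - Q) * norm (R - Q)))"

definition non_obtuse_triangle :: "real ^ 2 \<Rightarrow> real ^ 2 \<Rightarrow> real ^ 2 \<Rightarrow> bool" where
  "non_obtuse_triangle A B C \<longleftrightarrow>
     \<not> collinear {A, B, C} \<and>
     vertex_angle B A C \<le> pi / 2 \<and>
     vertex_angle A B C \<le> pi / 2 \<and>
     vertex_angle A C B \<le> pi / 2"

definition apex :: "real ^ 2 \<Rightarrow> real \<Rightarrow> real ^ 2" where
  "apex C t = (1 - t) *\<^sub>R C"

definition triangle_flow :: "real ^ 2 \<Rightarrow> real ^ 2 \<Rightarrow> real ^ 2 \<Rightarrow> real \<Rightarrow> (real ^ 2) set" where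
  "triangle_flow A B C t =
     (\<lambda>x. sqrt (dist 0 C / dist 0 (apex C t)) *\<^sub>R x) ` triangle_region A B (apex C t)"

end

theory Submission
  imports Defs
begin

text \<open>
  For a triangle with vertex \<open>V\<close> and edge vectors \<open>b\<close>, \<open>c\<close>, the coordinates \<open>V + u b + v c\<close> turn
  the interaction into \<open>det(b, c)\<^sup>2 \<integral> K(|u b + v c|) g(u, v)\<close>, where \<open>g\<close> is the covariogram of the
  standard simplex. Sliding the vertex \<open>V + c\<close> along its edge towards \<open>V\<close> and rescaling to the old
  area replaces \<open>(b, c)\<close> by \<open>(b / \<mu>, \<mu> c)\<close> with \<open>\<mu> < 1\<close>. With \<open>\<rho> = \<mu> |c| / |b|\<close> the area-preserving
  involution \<open>\<tau>(u, v) = (\<rho> v, u / \<rho>)\<close> exchanges the two quadratic forms \<open>|u b + v c|\<^sup>2\<close> and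
  \<open>|u b / \<mu> + v \<mu> c|\<^sup>2\<close>; it is the reflection across the angle bisector at \<open>V\<close> of the triangle halfway
  between the old and the new one. So the difference \<open>F\<close> of the two kernels is odd under \<open>\<tau>\<close>, and twice
  the change of the interaction is \<open>\<integral> F (g - g \<circ> \<tau>)\<close>. For \<open>\<rho> > 1\<close> both factors are nonnegative where
  \<open>|u| \<le> \<rho> |v|\<close>, hence the integrand is nonnegative everywhere and the interaction increases.

  Lowering the apex over the base \<open>A B\<close> is the composition of a slide of the apex towards \<open>A\<close> and
  a slide towards \<open>B\<close>; the condition \<open>|B C\<^sub>t| > |A B|\<close> guarantees \<open>\<rho> > 1\<close> for both.
\<close>

subsection \<open>Linear coordinates in the plane\<close>

definition lin_comb :: "'a::real_vector \<Rightarrow> 'a \<Rightarrow> real \<times> real \<Rightarrow> 'a" where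
  "lin_comb b c z = fst z *\<^sub>R b + snd z *\<^sub>R c"

definition det2 :: "real ^ 2 \<Rightarrow> real ^ 2 \<Rightarrow> real" where
  "det2 b c = b $ 1 * c $ 2 - c $ 1 * b $ 2"

lemma continuous_on_lin_comb [continuous_intros]:
  fixes b c :: "'a::real_normed_vector"
  shows "continuous_on S (lin_comb b c)"
  unfolding lin_comb_def by (intro continuous_intros)

lemma borel_measurable_lin_comb [measurable]:
  fixes b c :: "'a::euclidean_space"
  shows "lin_comb b c \<in> borel_measurable borel"
  by (intro borel_measurable_continuous_onI continuous_on_lin_comb)

lemma lin_comb_diff: "lin_comb b c (x - y) = lin_comb b c x - lin_comb b c y"
  by (simp add: lin_comb_def algebra_simps)

lemma box_prod:
  fixes l u :: "real \<times> real"
  shows "box l u = {fst l<..<fst u} \<times> {snd l<..<snd u}"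
  by (auto simp: box_def Basis_prod_def inner_prod_def)

lemma emeasure_lborel_rectangle:
  fixes a b c d :: real
  assumes "a \<le> b" "c \<le> d"
  shows "emeasure lborel ({a<..<b} \<times> {c<..<d}) = ennreal ((b - a) * (d - c))"
proof -
  have "emeasure lborel ({a<..<b} \<times> {c<..<d}) = emeasure (lborel \<Otimes>\<^sub>M lborel) ({a<..<b} \<times> {c<..<d})"
    by (simp add: lborel_prod)
  also have "\<dots> = emeasure lborel {a<..<b} * emeasure lborel {c<..<d}"
    by (rule lborel.emeasure_pair_measure_Times) auto
  also have "\<dots> = ennreal ((b - a) * (d - c))"
    using assms by (simp add: ennreal_mult)
  finally show ?thesis .
qed

lemma emeasure_lborel_box_prod:
  fixes l u :: "real \<times> real"
  assumes "\<And>b. b \<in> Basis \<Longrightarrow> l \<bullet> b \<le> u \<bullet> b"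
  shows "(\<Prod>b\<in>Basis. (u - l) \<bullet> b) = (fst u - fst l) * (snd u - snd l)"
    and "fst l \<le> fst u" "snd l \<le> snd u"
proof -
  have B: "Basis = {(1, 0), (0, 1) :: real \<times> real}" by (auto simp: Basis_prod_def)
  show "(\<Prod>b\<in>Basis. (u - l) \<bullet> b) = (fst u - fst l) * (snd u - snd l)"
    unfolding B by (simp add: inner_prod_def)
  show "fst l \<le> fst u" "snd l \<le> snd u" using assms[of "(1,0)"] assms[of "(0,1)"]
    by (auto simp: B inner_prod_def)
qed

definition skew_swap :: "real \<Rightarrow> real \<times> real \<Rightarrow> real \<times> real" where
  "skew_swap \<rho> z = (\<rho> * snd z, fst z / \<rho>)"

lemma borel_measurable_skew_swap [measurable]: "skew_swap \<rho> \<in> borel_measurable borel"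
  unfolding skew_swap_def divide_inverse
  by (intro borel_measurable_continuous_onI continuous_intros)

lemma skew_swap_skew_swap: "\<rho> \<noteq> 0 \<Longrightarrow> skew_swap \<rho> (skew_swap \<rho> z) = z"
  by (simp add: skew_swap_def)

text \<open>The preimage of a box is again a box: its side lengths are interchanged and multiplied
  by \<open>\<rho>\<close> and \<open>1 / \<rho>\<close>, so areas are preserved.\<close>

lemma distr_skew_swap:
  assumes "\<rho> > 0"
  shows "distr lborel borel (skew_swap \<rho>) = lborel"
proof (rule lborel_eqI[symmetric])
  fix l u :: "real \<times> real"
  assume lu: "\<And>b. b \<in> Basis \<Longrightarrow> l \<bullet> b \<le> u \<bullet> b"
  note * = emeasure_lborel_box_prod[OF lu]
  have vim: "skew_swap \<rho> -` box l u = {\<rho> * snd l<..<\<rho> * snd u} \<times> {fst l / \<rho><..<fst u / \<rho>}"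
    using assms by (auto simp: box_prod skew_swap_def field_simps)
  have "emeasure (distr lborel borel (skew_swap \<rho>)) (box l u)
      = emeasure lborel ({\<rho> * snd l<..<\<rho> * snd u} \<times> {fst l / \<rho><..<fst u / \<rho>})"
    by (subst emeasure_distr) (auto simp: vim)
  also have "\<dots> = ennreal ((\<rho> * snd u - \<rho> * snd l) * (fst u / \<rho> - fst l / \<rho>))"
    using assms * by (intro emeasure_lborel_rectangle) (auto intro: divide_right_mono mult_left_mono)
  also have "(\<rho> * snd u - \<rho> * snd l) * (fst u / \<rho> - fst l / \<rho>) = (fst u - fst l) * (snd u - snd l)"
    using assms by (simp add: field_simps)
  finally show "emeasure (distr lborel borel (skew_swap \<rho>)) (box l u) = (\<Prod>b\<in>Basis. (u - l) \<bullet> b)"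
    using * by simp
qed simp

lemma borel_measurable_vector_2:
  "(\<lambda>z. vector [fst z, snd z] :: real ^ 2) \<in> borel_measurable borel"
proof -
  have "(\<lambda>z. vector [fst z, snd z] :: real ^ 2) = lin_comb (axis 1 1) (axis 2 1)"
    by (auto simp: lin_comb_def fun_eq_iff vec_eq_iff forall_2 axis_def)
  then show ?thesis by (simp add: borel_measurable_lin_comb)
qed

text \<open>Identifies the two models of the plane: Fubini and product sets are handled in
  \<open>real \<times> real\<close>, the determinant formula for linear images in
  \<open>real ^ 2\<close>.\<close>

lemma distr_vector_2:
  "distr lborel borel (\<lambda>z. vector [fst z, snd z] :: real ^ 2) = lborel" (is "distr _ _ ?V = _")
proof (rule lborel_eqI[symmetric])
  note borel_measurable_vector_2 [measurable]
  fix l u :: "real ^ 2"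
  assume lu: "\<And>b. b \<in> Basis \<Longrightarrow> l \<bullet> b \<le> u \<bullet> b"
  have le: "l $ 1 \<le> u $ 1" "l $ 2 \<le> u $ 2"
    using lu[of "axis 1 1"] lu[of "axis 2 1"] by (auto simp: inner_axis axis_in_Basis_iff)
  have vim: "?V -` box l u = {l $ 1<..<u $ 1} \<times> {l $ 2<..<u $ 2}"
    by (auto simp: mem_box_cart forall_2)
  have "emeasure (distr lborel borel ?V) (box l u) = emeasure lborel ({l $ 1<..<u $ 1} \<times> {l $ 2<..<u $ 2})"
    by (subst emeasure_distr) (auto simp: vim)
  also have "\<dots> = ennreal ((u $ 1 - l $ 1) * (u $ 2 - l $ 2))"
    using le by (rule emeasure_lborel_rectangle)
  also have "(u $ 1 - l $ 1) * (u $ 2 - l $ 2) = (\<Prod>b\<in>Basis. (u - l) \<bullet> b)"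
  proof -
    have "(\<Prod>b\<in>Basis. (u - l) \<bullet> b) = (\<Prod>i\<in>UNIV. (u - l) \<bullet> axis i 1)"
      by (simp add: Basis_vec_def axis_eq_axis prod.UNION_disjoint)
    then show ?thesis by (simp add: UNIV_2 inner_axis axis_eq_axis)
  qed
  finally show "emeasure (distr lborel borel ?V) (box l u) = (\<Prod>b\<in>Basis. (u - l) \<bullet> b)" .
qed simp

text \<open>The map is the identification of the two planes followed by a linear endomorphism of
  determinant \<open>det2 b c\<close>; by uniqueness of Lebesgue measure, comparing boxes is
  enough.\<close>

lemma distr_lin_comb:
  fixes b c :: "real ^ 2"
  assumes d: "det2 b c \<noteq> 0"
  shows "density (distr lborel borel (lin_comb b c)) (\<lambda>_. ennreal \<bar>det2 b c\<bar>) = lborel"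
proof (rule lborel_eqI[symmetric])
  let ?V = "\<lambda>z. vector [fst z, snd z] :: real ^ 2"
  let ?f = "\<lambda>x :: real ^ 2. x $ 1 *\<^sub>R b + x $ 2 *\<^sub>R c"
  have lin: "linear ?f"
    by (intro linearI) (auto simp: algebra_simps)
  have dm: "det (matrix ?f) = det2 b c"
    by (simp add: det_2 matrix_def det2_def axis_def mult.commute)
  have inj: "inj ?f"
    using det_nz_iff_inj[OF lin] d dm by simp
  then have surj: "surj ?f"
    using lin linear_injective_imp_surjective by blast
  fix l u :: "real ^ 2"
  assume lu: "\<And>b. b \<in> Basis \<Longrightarrow> l \<bullet> b \<le> u \<bullet> b"
  let ?P = "?f -` box l u"
  have fm [measurable]: "?f \<in> borel_measurable borel"
    by (intro borel_measurable_continuous_onI continuous_intros)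
  have img: "?f ` ?P = box l u"
    using surj by (rule surj_image_vimage_eq)
  \<comment> \<open>The preimage has finite measure because it is the image of a box under the
    inverse map.\<close>
  have "linear (inv ?f)"
    using lin inj by (rule inj_linear_imp_inv_linear)
  have "?P = inv ?f ` box l u"
    using bij_vimage_eq_inv_image[of ?f] inj surj by (simp add: bij_def)
  then have Pm: "?P \<in> lmeasurable"
    using measurable_linear_image[OF \<open>linear (inv ?f)\<close>, of "box l u"] by simp
  have Pb: "?P \<in> sets borel" using measurable_sets_borel[OF fm, of "box l u"] by simp
  have "measure lebesgue (box l u) = \<bar>det2 b c\<bar> * measure lebesgue ?P"
    using measure_linear_image[OF lin Pm] dm img by simp
  then have meas: "measure lborel (box l u) = \<bar>det2 b c\<bar> * measure lborel ?P"
    using Pb by (simp add: measure_completion)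
  have Pf: "emeasure lborel ?P = ennreal (measure lborel ?P)"
    using Pm Pb by (intro emeasure_eq_ennreal_measure) (auto simp: fmeasurable_def)
  have "lin_comb b c = ?f \<circ> ?V" by (auto simp: lin_comb_def fun_eq_iff)
  then have "distr lborel borel (lin_comb b c) = distr (distr lborel borel ?V) borel ?f"
    using borel_measurable_vector_2 by (subst distr_distr) auto
  then have D: "distr lborel borel (lin_comb b c) = distr lborel borel ?f"
    by (simp add: distr_vector_2)
  have "emeasure (density (distr lborel borel (lin_comb b c)) (\<lambda>_. ennreal \<bar>det2 b c\<bar>)) (box l u)
      = ennreal \<bar>det2 b c\<bar> * emeasure lborel ?P"
    by (simp add: D emeasure_density_const emeasure_distr)
  also have "\<dots> = ennreal (measure lborel (box l u))"
    by (simp add: Pf meas ennreal_mult)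
  also have "\<dots> = emeasure lborel (box l u)"
    by (intro emeasure_eq_ennreal_measure[symmetric]) (simp add: emeasure_lborel_box_eq)
  also have "\<dots> = (\<Prod>b\<in>Basis. (u - l) \<bullet> b)" using lu by simp
  finally show "emeasure (density (distr lborel borel (lin_comb b c)) (\<lambda>_. ennreal \<bar>det2 b c\<bar>)) (box l u)
      = (\<Prod>b\<in>Basis. (u - l) \<bullet> b)" .
qed simp

text \<open>Measurability of \<open>f\<close> suffices: without integrability both sides take the
  default value 0. Hence the substitution can be made in iterated integrals before integrability is
  settled.\<close>

lemma integral_lin_comb:
  fixes b c V :: "real ^ 2" and f :: "real ^ 2 \<Rightarrow> real"
  assumes "det2 b c \<noteq> 0" and [measurable]: "f \<in> borel_measurable borel"
  shows "integral\<^sup>L lborel f = \<bar>det2 b c\<bar> * (\<integral>z. f (V + lin_comb b c z) \<partial>lborel)"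
proof -
  have "integral\<^sup>L lborel f = integral\<^sup>L (distr lborel borel ((+) V)) f"
    by (simp add: lborel_distr_plus)
  also have "\<dots> = (\<integral>x. f (V + x) \<partial>lborel)"
    by (intro integral_distr) auto
  also have "\<dots> = (\<integral>x. f (V + x) \<partial>density (distr lborel borel (lin_comb b c)) (\<lambda>_. ennreal \<bar>det2 b c\<bar>))"
    by (simp add: distr_lin_comb assms)
  also have "\<dots> = \<bar>det2 b c\<bar> * (\<integral>z. f (V + lin_comb b c z) \<partial>lborel)"
    by (subst integral_density) (auto simp: integral_distr)
  finally show ?thesis .
qed

lemma integral_reflect:
  fixes f :: "'a::euclidean_space \<Rightarrow> real"
  assumes [measurable]: "f \<in> borel_measurable borel"
  shows "(\<integral>y. f (x - y) \<partial>lborel) = integral\<^sup>L lborel f"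
proof -
  have "lborel = distr lborel borel (\<lambda>y :: 'a. x - y)"
    using lborel_affine[of "-1" x] by (simp add: density_1)
  then have "integral\<^sup>L lborel f = integral\<^sup>L (distr lborel borel (\<lambda>y. x - y)) f" by simp
  also have "\<dots> = (\<integral>y. f (x - y) \<partial>lborel)" by (intro integral_distr) auto
  finally show ?thesis by simp
qed

subsection \<open>The covariogram of the standard simplex\<close>

text \<open>The standard simplex scaled to size \<open>m\<close>. A negative \<open>m\<close> gives
  the empty set, which covers disjoint translates without a case distinction.\<close>

definition corner :: "real \<Rightarrow> (real \<times> real) set" where
  "corner m = {z. 0 \<le> fst z \<and> 0 \<le> snd z \<and> fst z + snd z \<le> m}"

lemma borel_corner [measurable]: "corner m \<in> sets borel"
proof -
  have "closed (corner m)" unfolding corner_def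
    by (intro closed_Collect_conj closed_Collect_le continuous_intros)
  then show ?thesis by simp
qed

lemma corner_subset_cbox: "corner m \<subseteq> cbox (0, 0) (m, m)"
  by (auto simp: corner_def cbox_Pair_eq)

lemma emeasure_corner_finite: "emeasure lborel (corner m) < \<infinity>"
proof -
  have "bounded (corner m)" using corner_subset_cbox bounded_cbox bounded_subset by blast
  then show ?thesis by (rule emeasure_bounded_finite)
qed

lemma fmeasurable_corner: "corner m \<in> fmeasurable lborel"
  using emeasure_corner_finite by (auto simp: fmeasurable_def)

lemma measure_corner_mono: "m \<le> n \<Longrightarrow> measure lborel (corner m) \<le> measure lborel (corner n)"
  by (rule measure_mono_fmeasurable) (auto simp: fmeasurable_corner, auto simp: corner_def)

lemma measure_corner_strict_mono:
  assumes "m < n" "0 < n"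
  shows "measure lborel (corner m) < measure lborel (corner n)"
proof -
  let ?m = "max m 0"
  \<comment> \<open>On this square the coordinate sum lies strictly between \<open>?m\<close> and
    \<open>n\<close>, so it is contained in \<open>corner n\<close> and misses
    \<open>corner m\<close>.\<close>
  let ?B = "{?m / 2<..<n / 2} \<times> {?m / 2<..<n / 2}"
  have Bm: "emeasure lborel ?B = ennreal ((n / 2 - ?m / 2) * (n / 2 - ?m / 2))"
    using assms by (intro emeasure_lborel_rectangle) auto
  have Bs: "?B \<in> sets lborel"
    by (simp add: open_Times)
  then have Bf: "?B \<in> fmeasurable lborel" using Bm by (auto simp: fmeasurable_def)
  have Bp: "measure lborel ?B > 0" using Bm assms by (simp add: measure_def enn2real_ennreal)
  have "measure lborel (corner m) + measure lborel ?B = measure lborel (corner m \<union> ?B)"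
    by (rule measure_Un_AE[symmetric]) (use fmeasurable_corner Bf in \<open>auto simp: corner_def\<close>)
  also have "\<dots> \<le> measure lborel (corner n)"
    by (rule measure_mono_fmeasurable)
       (use fmeasurable_corner Bs assms in \<open>auto, auto simp: corner_def\<close>)
  finally show ?thesis using Bp by simp
qed

text \<open>The norm whose unit ball is the difference body of the simplex.\<close>
definition gauge :: "real \<times> real \<Rightarrow> real" where
  "gauge z = max (max 0 (fst z) + max 0 (snd z)) (max 0 (- fst z) + max 0 (- snd z))"

text \<open>The overlap is cut out by lower bounds \<open>max 0 (fst z)\<close>,
  \<open>max 0 (snd z)\<close> on the coordinates and the upper bound
  \<open>min 1 (1 + fst z + snd z)\<close> on their sum. Moving the lower bounds to 0 leaves
  \<open>1 - gauge z\<close> as the bound on the sum.\<close>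

lemma corner_Int_translate:
  "corner 1 \<inter> {x. x - z \<in> corner 1} = (+) (max 0 (fst z), max 0 (snd z)) ` corner (1 - gauge z)"
proof -
  have "(+) p ` S = {x. x - p \<in> S}" for p :: "real \<times> real" and S
    by (force simp: image_iff intro: bexI[where x = "_ - p"])
  then show ?thesis
    by (auto simp: corner_def gauge_def max_def split: if_splits)
qed

definition covariogram :: "real \<times> real \<Rightarrow> real" where
  "covariogram z = (\<integral>x. indicator (corner 1) x * indicator (corner 1) (x - z) \<partial>lborel)"

text \<open>The covariogram is thus a decreasing function of \<open>gauge z\<close>, which reduces
  all comparisons of its values to the gauge.\<close>

lemma covariogram_eq: "covariogram z = measure lborel (corner (1 - gauge z))"
proof -
  let ?p = "(max 0 (fst z), max 0 (snd z))"
  have "covariogram z = (\<integral>x. indicator (corner 1 \<inter> {x. x - z \<in> corner 1}) x \<partial>lborel)"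
    unfolding covariogram_def by (intro Bochner_Integration.integral_cong) (auto simp: indicator_def)
  also have "\<dots> = measure lborel ((+) ?p ` corner (1 - gauge z))"
    by (simp add: corner_Int_translate)
  also have "\<dots> = measure lebesgue ((+) ?p ` corner (1 - gauge z))"
    using corner_Int_translate[of z, symmetric] by (simp add: measure_completion)
  also have "\<dots> = measure lborel (corner (1 - gauge z))"
    by (simp add: measure_translation measure_completion)
  finally show ?thesis .
qed

text \<open>The map interchanges the signs of the coordinates. For equal signs the gauge is the sum
  of the absolute values, which grows by \<open>(\<rho> - 1) * (\<rho> * \<bar>snd z\<bar> -
  \<bar>fst z\<bar>) / \<rho>\<close>; for opposite signs it is their maximum, and
  \<open>\<rho> * \<bar>snd z\<bar>\<close> dominates both.\<close>

lemma gauge_skew_swap: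
  assumes "\<rho> \<ge> 1" "\<bar>fst z\<bar> \<le> \<rho> * \<bar>snd z\<bar>"
  shows "gauge z \<le> gauge (skew_swap \<rho> z)"
proof -
  define u v where "u = fst z / \<rho>" and "v = \<rho> * snd z"
  have uv: "fst z = \<rho> * u" "snd z = v / \<rho>" "\<bar>fst z\<bar> \<le> \<bar>v\<bar>"
    using assms by (auto simp: u_def v_def abs_mult)
  have "0 \<le> (\<rho> - 1) * (\<bar>v\<bar> - \<bar>\<rho> * u\<bar>) / \<rho>" using assms uv by simp
  also have "\<dots> = \<bar>v\<bar> + \<bar>u\<bar> - \<bar>fst z\<bar> - \<bar>snd z\<bar>"
    using assms(1) unfolding uv(1,2) by (simp add: field_simps abs_mult abs_divide)
  finally have sum: "\<bar>fst z\<bar> + \<bar>snd z\<bar> \<le> \<bar>v\<bar> + \<bar>u\<bar>" by simp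
  have vz: "\<bar>snd z\<bar> \<le> \<bar>v\<bar>" unfolding v_def using assms by (simp add: abs_mult mult_le_cancel_right1)
  have sg: "fst z \<ge> 0 \<longleftrightarrow> u \<ge> 0" "snd z \<ge> 0 \<longleftrightarrow> v \<ge> 0" "fst z \<le> 0 \<longleftrightarrow> u \<le> 0" "snd z \<le> 0 \<longleftrightarrow> v \<le> 0"
    unfolding u_def v_def using assms
    by (auto simp: zero_le_mult_iff zero_le_divide_iff mult_le_0_iff divide_le_0_iff)
  have "skew_swap \<rho> z = (v, u)" by (simp add: skew_swap_def u_def v_def)
  then show ?thesis
    using sum vz sg uv(3) unfolding gauge_def by (simp add: max_def abs_if split: if_splits)
qed

text \<open>Strictness in part of the open first quadrant is enough, since it only has to hold on a
  set of positive measure.\<close>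

lemma gauge_skew_swap_strict:
  assumes "\<rho> > 1" "0 < fst z" "0 < snd z" "fst z < \<rho> * snd z"
  shows "gauge z < gauge (skew_swap \<rho> z)"
proof -
  have "0 < (\<rho> - 1) * (\<rho> * snd z - fst z) / \<rho>" using assms by simp
  also have "\<dots> = \<rho> * snd z + fst z / \<rho> - (fst z + snd z)"
    using assms by (simp add: field_simps)
  finally show ?thesis
    using assms unfolding gauge_def skew_swap_def by (simp add: max_def)
qed

lemma gauge_ge: "\<bar>fst z\<bar> \<le> gauge z" "\<bar>snd z\<bar> \<le> gauge z"
  by (auto simp: gauge_def max_def)

lemma covariogram_eq_0:
  assumes "z \<notin> cbox (-1, -1) (1, 1)"
  shows "covariogram z = 0"
proof -
  have "1 < gauge z" using assms gauge_ge[of z] by (auto simp: cbox_Pair_eq mem_Times_iff)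
  then have "corner (1 - gauge z) = {}" by (auto simp: corner_def)
  then show ?thesis by (simp add: covariogram_eq)
qed

lemma borel_measurable_covariogram [measurable]: "covariogram \<in> borel_measurable borel"
proof -
  have g: "gauge \<in> borel_measurable borel"
    unfolding gauge_def by (intro borel_measurable_continuous_onI continuous_intros)
  \<comment> \<open>Monotone functions are Borel, so the area of \<open>corner m\<close> need not be
    computed.\<close>
  have "mono (\<lambda>m. measure lborel (corner m))" by (intro monoI measure_corner_mono)
  then have "(\<lambda>m. measure lborel (corner m)) \<in> borel_measurable borel" by (rule borel_measurable_mono)
  from measurable_compose[OF _ this, of "\<lambda>z. 1 - gauge z"] g show ?thesis
    by (simp add: covariogram_eq[abs_def])
qed

lemma covariogram_bounds: "0 \<le> covariogram z" "covariogram z \<le> measure lborel (corner 1)"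
proof -
  have "0 \<le> gauge z" using gauge_ge[of z] by linarith
  then show "0 \<le> covariogram z" "covariogram z \<le> measure lborel (corner 1)"
    by (auto simp: covariogram_eq intro: measure_corner_mono)
qed

text \<open>The covariogram is bounded and vanishes off the square
  \<open>cbox (-1, -1) (1, 1)\<close>, so integrability of \<open>k\<close> on that square
  suffices.\<close>

lemma integrable_mult_covariogram:
  assumes [measurable]: "k \<in> borel_measurable borel"
    and k: "set_integrable lborel (cbox (-1, -1) (1, 1)) k"
    and h [measurable]: "h \<in> borel_measurable borel" and hb: "\<And>z. \<bar>h z\<bar> \<le> covariogram z"
  shows "integrable lborel (\<lambda>z. k z * h z)"
proof (rule Bochner_Integration.integrable_bound)
  show "integrable lborel (\<lambda>z. measure lborel (corner 1) * (indicator (cbox (-1, -1) (1, 1)) z * k z))"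
    using k by (simp add: set_integrable_def)
  have "\<bar>k z\<bar> * \<bar>h z\<bar> \<le> measure lborel (corner 1) * \<bar>indicator (cbox (-1, -1) (1, 1)) z * k z\<bar>" for z
  proof (cases "z \<in> cbox (-1, -1) (1, 1)")
    case True
    then show ?thesis using hb[of z] covariogram_bounds(2)[of z]
      by (simp add: mult.commute[of "measure _ _"] mult.commute[of "\<bar>h z\<bar>"] mult_left_mono)
  next
    case False
    then show ?thesis using hb[of z] covariogram_eq_0[of z] by simp
  qed
  then show "AE z in lborel. norm (k z * h z)
      \<le> norm (measure lborel (corner 1) * (indicator (cbox (-1, -1) (1, 1)) z * k z))"
    by (simp add: abs_mult)
qed simp

text \<open>Substituting \<open>z = x - y\<close> and exchanging the integrals leaves, for each
  \<open>z\<close>, the area of the points \<open>x\<close> with \<open>x\<close> and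
  \<open>x - z\<close> in the simplex.\<close>

lemma integral_corner_corner:
  fixes k :: "real \<times> real \<Rightarrow> real"
  assumes km [measurable]: "k \<in> borel_measurable borel"
    and k: "set_integrable lborel (cbox (-1, -1) (1, 1)) k"
  shows "(\<integral>x. indicator (corner 1) x * (\<integral>y. indicator (corner 1) y * k (x - y) \<partial>lborel) \<partial>lborel)
      = (\<integral>z. k z * covariogram z \<partial>lborel)"
proof -
  let ?I = "indicator (corner 1) :: real \<times> real \<Rightarrow> real"
  let ?C = "indicator (cbox (-1, -1) (1, 1)) :: real \<times> real \<Rightarrow> real"
  have inner: "(\<integral>y. ?I y * k (x - y) \<partial>lborel) = (\<integral>z. ?I (x - z) * k z \<partial>lborel)" for x
    using integral_reflect[of "\<lambda>y. ?I y * k (x - y)" x] by simp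
  \<comment> \<open>Differences of points of the simplex lie in the square, so \<open>k\<close> may
    be cut off there; the cutoff provides the integrable majorant for Fubini.\<close>
  have kI: "?I x * (?I (x - z) * k z) = ?I x * (?I (x - z) * (?C z * k z))" for x z
  proof (cases "x \<in> corner 1 \<and> x - z \<in> corner 1")
    case True
    then have "z \<in> cbox (-1, -1) (1, 1)"
      by (auto simp: corner_def cbox_Pair_eq mem_Times_iff)
    then show ?thesis by simp
  qed (auto simp: indicator_def)
  have int_prod: "integrable (lborel \<Otimes>\<^sub>M lborel) (\<lambda>(x, z). ?I x * (?I (x - z) * (?C z * k z)))"
  proof (rule Bochner_Integration.integrable_bound)
    have I: "integrable lborel ?I"
      using emeasure_corner_finite by (simp add: integrable_indicator_iff)
    have C: "integrable lborel (\<lambda>z. ?C z * k z)" using k by (simp add: set_integrable_def)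
    show "integrable (lborel \<Otimes>\<^sub>M lborel) (\<lambda>(x, z). ?I x * (?C z * k z))"
      by (rule lborel_pair.Fubini_integrable) (use I C in \<open>auto simp: abs_mult\<close>)
    show "AE p in lborel \<Otimes>\<^sub>M lborel. norm (case p of (x, z) \<Rightarrow> ?I x * (?I (x - z) * (?C z * k z)))
        \<le> norm (case p of (x, z) \<Rightarrow> ?I x * (?C z * k z))"
      by (intro AE_I2) (auto simp: indicator_def)
    have "(\<lambda>p. fst p - snd p) \<in> lborel \<Otimes>\<^sub>M lborel \<rightarrow>\<^sub>M (borel :: (real \<times> real) measure)" by simp
    then show "(\<lambda>(x, z). ?I x * (?I (x - z) * (?C z * k z))) \<in> borel_measurable (lborel \<Otimes>\<^sub>M lborel)"
      by (simp add: case_prod_beta) measurable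
  qed
  have "(\<integral>x. ?I x * (\<integral>y. ?I y * k (x - y) \<partial>lborel) \<partial>lborel)
      = (\<integral>x. (\<integral>z. ?I x * (?I (x - z) * (?C z * k z)) \<partial>lborel) \<partial>lborel)"
    by (simp only: inner integral_mult_right_zero[symmetric] kI)
  also have "\<dots> = (\<integral>z. (\<integral>x. ?I x * (?I (x - z) * (?C z * k z)) \<partial>lborel) \<partial>lborel)"
    using lborel_pair.Fubini_integral[OF int_prod] by simp
  also have "\<dots> = (\<integral>z. k z * covariogram z \<partial>lborel)"
    by (simp only: kI[symmetric]) (simp add: covariogram_def mult_ac)
  finally show ?thesis .
qed

text \<open>By Cramer's rule each coordinate of \<open>z\<close> is a determinant involving
  \<open>lin_comb b c z\<close>, hence bounded by a multiple of its norm.\<close>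

lemma norm_lin_comb_ge:
  assumes "det2 b c \<noteq> 0"
  obtains d where "0 < d" "d < 1" "\<And>z. d * max \<bar>fst z\<bar> \<bar>snd z\<bar> \<le> norm (lin_comb b c z)"
proof -
  \<comment> \<open>The summand \<open>1 + \<bar>det2 b c\<bar>\<close> forces the constant
    \<open>\<bar>det2 b c\<bar> / M\<close> below 1, as \<open>integrable_kernel_max\<close>
    requires.\<close>
  define M where "M = 1 + \<bar>det2 b c\<bar> + \<bar>b $ 1\<bar> + \<bar>b $ 2\<bar> + \<bar>c $ 1\<bar> + \<bar>c $ 2\<bar>"
  have M: "M > 0" by (simp add: M_def add_pos_nonneg)
  have "\<bar>det2 b c\<bar> * max \<bar>fst z\<bar> \<bar>snd z\<bar> \<le> M * norm (lin_comb b c z)" for z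
  proof -
    let ?x = "lin_comb b c z"
    have n: "\<bar>?x $ 1\<bar> \<le> norm ?x" "\<bar>?x $ 2\<bar> \<le> norm ?x" by (rule component_le_norm_cart)+
    have det: "\<bar>det2 v w\<bar> \<le> norm v * (\<bar>w $ 1\<bar> + \<bar>w $ 2\<bar>)" for v w
    proof -
      have "\<bar>v $ 1 * w $ 2\<bar> \<le> norm v * \<bar>w $ 2\<bar>" "\<bar>w $ 1 * v $ 2\<bar> \<le> norm v * \<bar>w $ 1\<bar>"
        unfolding abs_mult by (auto simp: mult.commute[of "\<bar>w $ 1\<bar>"] intro!: mult_right_mono component_le_norm_cart)
      then show ?thesis unfolding det2_def by (simp add: algebra_simps)
    qed
    have "det2 ?x c = fst z * det2 b c" "det2 ?x b = - snd z * det2 b c"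
      by (auto simp: det2_def lin_comb_def algebra_simps)
    then have "\<bar>fst z\<bar> * \<bar>det2 b c\<bar> \<le> norm ?x * (\<bar>c $ 1\<bar> + \<bar>c $ 2\<bar>)"
        "\<bar>snd z\<bar> * \<bar>det2 b c\<bar> \<le> norm ?x * (\<bar>b $ 1\<bar> + \<bar>b $ 2\<bar>)"
      using det[of ?x c] det[of ?x b] by (auto simp: abs_mult)
    moreover have "norm ?x * (\<bar>c $ 1\<bar> + \<bar>c $ 2\<bar>) \<le> norm ?x * M" "norm ?x * (\<bar>b $ 1\<bar> + \<bar>b $ 2\<bar>) \<le> norm ?x * M"
      by (auto simp: M_def intro!: mult_left_mono)
    ultimately have "\<bar>fst z\<bar> * \<bar>det2 b c\<bar> \<le> norm ?x * M" "\<bar>snd z\<bar> * \<bar>det2 b c\<bar> \<le> norm ?x * M"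
      by linarith+
    then show ?thesis by (auto simp: max_def mult.commute)
  qed
  then have "\<bar>det2 b c\<bar> / M * max \<bar>fst z\<bar> \<bar>snd z\<bar> \<le> norm (lin_comb b c z)" for z
    using M by (simp add: field_simps)
  moreover have "\<bar>det2 b c\<bar> / M < 1" using M by (simp add: M_def)
  moreover have "0 < \<bar>det2 b c\<bar> / M" using M assms by simp
  ultimately show ?thesis using that by blast
qed

subsection \<open>Interaction of a triangle\<close>

locale radial_kernel =
  fixes K :: "real \<Rightarrow> real"
  assumes measurable_kernel [measurable]: "K \<in> borel_measurable borel"
    and kernel_decreasing: "strict_antimono_on {0<..} K"
    and kernel_integrable: "set_integrable lborel {0<..<1} (\<lambda>r. K r * r)"
begin

lemma kernel_le: "0 < r \<Longrightarrow> r \<le> s \<Longrightarrow> K s \<le> K r"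
  using kernel_decreasing by (cases "r = s") (auto simp: monotone_on_def intro: less_imp_le)

lemma kernel_less: "0 < r \<Longrightarrow> r < s \<Longrightarrow> K s < K r"
  using kernel_decreasing by (auto simp: monotone_on_def)

text \<open>Integrating over \<open>v\<close> in \<open>{-\<bar>u\<bar>..\<bar>u\<bar>}\<close>
  yields the factor \<open>2 * \<bar>u\<bar>\<close>, which is the weight \<open>r\<close> in the
  hypothesis on \<open>K\<close>. The function serves as a majorant where
  \<open>\<bar>u\<bar>\<close> is the larger coordinate.\<close>

lemma integrable_kernel_max:
  assumes c: "0 < c" "c < 1"
  shows "integrable lborel (\<lambda>(u, v). indicator {-1..1} u * (indicator {-\<bar>u\<bar>..\<bar>u\<bar>} v * \<bar>K (c * \<bar>u\<bar>)\<bar>))"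
    (is "integrable _ ?f")
proof -
  define \<psi> where "\<psi> r = indicator {0<..<1} r * (K r * r)" for r :: real
  have \<psi>: "integrable lborel \<psi>"
    using kernel_integrable by (simp add: \<psi>_def[abs_def] set_integrable_def)
  \<comment> \<open>The two substitutions account for positive and negative \<open>u\<close>; since
    \<open>c < 1\<close>, the argument \<open>c * \<bar>u\<bar>\<close> stays below 1.\<close>
  have "integrable lborel (\<lambda>u. \<psi> (0 + c * u))" "integrable lborel (\<lambda>u. \<psi> (0 + (- c) * u))"
    using c \<psi> by (intro lborel_integrable_real_affine; simp)+
  then have "integrable lborel (\<lambda>u. 2 / c * (\<bar>\<psi> (0 + c * u)\<bar> + \<bar>\<psi> (0 + (- c) * u)\<bar>))"
    by (intro integrable_mult_right Bochner_Integration.integrable_add integrable_abs)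
  then have int1: "integrable lborel (\<lambda>u. indicator {-1..1} u * (2 * \<bar>u\<bar> * \<bar>K (c * \<bar>u\<bar>)\<bar>) :: real)"
  proof (rule Bochner_Integration.integrable_bound)
    have "indicator {-1..1} u * (2 * \<bar>u\<bar> * \<bar>K (c * \<bar>u\<bar>)\<bar>)
        \<le> 2 / c * (\<bar>\<psi> (0 + c * u)\<bar> + \<bar>\<psi> (0 + (- c) * u)\<bar>)" for u
    proof (cases "u \<in> {-1..1}")
      case True
      then have "\<bar>c * u\<bar> \<le> c * 1" unfolding abs_mult using c by (intro mult_mono) auto
      then have "\<bar>c * u\<bar> < 1" using c by simp
      then show ?thesis
        using c True by (cases "u > 0"; cases "u = 0")
          (auto simp: \<psi>_def abs_mult indicator_def mult_less_0_iff zero_less_mult_iff field_simps)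
    qed (use c in auto)
    then show "AE u in lborel. norm (indicator {-1..1} u * (2 * \<bar>u\<bar> * \<bar>K (c * \<bar>u\<bar>)\<bar>))
        \<le> norm (2 / c * (\<bar>\<psi> (0 + c * u)\<bar> + \<bar>\<psi> (0 + (- c) * u)\<bar>))"
      using c by (intro AE_I2) (auto intro: order_trans[OF _ abs_ge_self])
  qed measurable
  have ind: "integrable lborel (indicator {-\<bar>u\<bar>..\<bar>u\<bar>} :: real \<Rightarrow> real)" for u :: real
    by (simp add: integrable_indicator_iff)
  have "{p :: real \<times> real. snd p \<in> {-\<bar>fst p\<bar>..\<bar>fst p\<bar>}} \<in> sets borel"
    by (simp add: borel_closed closed_Collect_conj closed_Collect_le continuous_intros)
  then have S: "{p :: real \<times> real. snd p \<in> {-\<bar>fst p\<bar>..\<bar>fst p\<bar>}} \<in> sets (borel \<Otimes>\<^sub>M borel)"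
    by (simp only: borel_prod)
  have eq: "?f = (\<lambda>p. indicator {-1..1} (fst p) *
      (indicator {p. snd p \<in> {-\<bar>fst p\<bar>..\<bar>fst p\<bar>}} p * \<bar>K (c * \<bar>fst p\<bar>)\<bar>))"
    by (auto simp: fun_eq_iff indicator_def)
  have "integrable (lborel \<Otimes>\<^sub>M lborel) ?f"
  proof (rule lborel_pair.Fubini_integrable)
    show "?f \<in> borel_measurable (lborel \<Otimes>\<^sub>M lborel)"
      unfolding eq using S by measurable
    show "integrable lborel (\<lambda>u. \<integral>v. norm (?f (u, v)) \<partial>lborel)"
    proof -
      have "(\<integral>v. norm (?f (u, v)) \<partial>lborel) = indicator {-1..1} u * (2 * \<bar>u\<bar> * \<bar>K (c * \<bar>u\<bar>)\<bar>)" for u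
      proof -
        have "(\<integral>v. norm (?f (u, v)) \<partial>lborel)
            = (\<integral>v. (indicator {-1..1} u * \<bar>K (c * \<bar>u\<bar>)\<bar>) * indicator {-\<bar>u\<bar>..\<bar>u\<bar>} v \<partial>lborel)"
          by (intro Bochner_Integration.integral_cong) (auto simp: indicator_def)
        then show ?thesis by simp
      qed
      then show ?thesis using int1 by simp
    qed
    show "AE u in lborel. integrable lborel (\<lambda>v. ?f (u, v))"
      using ind by (intro AE_I2) auto
  qed
  then show ?thesis by (simp add: lborel_prod)
qed

text \<open>By monotonicity \<open>K\<close> of the norm is controlled by \<open>K\<close> of a
  multiple of the larger coordinate. The coordinate swap \<open>skew_swap 1\<close> turns the
  majorant for one half of the square into the one for the other half.\<close>

lemma set_integrable_kernel_lin_comb: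
  assumes "det2 b c \<noteq> 0"
  shows "set_integrable lborel (cbox (-1, -1) (1, 1)) (\<lambda>z. K (norm (lin_comb b c z)))"
proof -
  obtain d where d: "0 < d" "d < 1" "\<And>z. d * max \<bar>fst z\<bar> \<bar>snd z\<bar> \<le> norm (lin_comb b c z)"
    using norm_lin_comb_ge[OF assms] by blast
  let ?f = "\<lambda>(u, v). indicator {-1..1} u * (indicator {-\<bar>u\<bar>..\<bar>u\<bar>} v * \<bar>K (d * \<bar>u\<bar>)\<bar>) :: real"
  let ?C = "indicator (cbox (-1, -1) (1, 1)) :: real \<times> real \<Rightarrow> real"
  let ?R = "norm b + norm c"
  have f: "integrable lborel ?f" using d by (intro integrable_kernel_max)
  have f': "integrable lborel (\<lambda>z. ?f (skew_swap 1 z))"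
    using integrable_distr[of "skew_swap 1" lborel borel ?f] f by (simp add: distr_skew_swap)
  have C: "integrable lborel ?C" using emeasure_bounded_finite[OF bounded_cbox, of "(-1, -1)" "(1, 1) :: real \<times> real"]
    by (simp add: integrable_indicator_iff)
  have "integrable lborel (\<lambda>z. ?C z * K (norm (lin_comb b c z)))"
  proof (rule Bochner_Integration.integrable_bound)
    show "integrable lborel (\<lambda>z. ?f z + ?f (skew_swap 1 z) + \<bar>K ?R\<bar> * ?C z)"
      using f f' C by (intro Bochner_Integration.integrable_add integrable_mult_right)
    \<comment> \<open>The origin, a null set, is left out because \<open>K\<close> is monotone only
      on positive arguments.\<close>
    have "norm (?C z * K (norm (lin_comb b c z)))
       \<le> norm (?f z + ?f (skew_swap 1 z) + \<bar>K ?R\<bar> * ?C z)" if z: "z \<noteq> 0" for z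
    proof (cases "z \<in> cbox (-1, -1) (1, 1)")
      case True
      then have z1: "\<bar>fst z\<bar> \<le> 1" "\<bar>snd z\<bar> \<le> 1" by (auto simp: cbox_Pair_eq mem_Times_iff)
      let ?m = "max \<bar>fst z\<bar> \<bar>snd z\<bar>"
      let ?n = "norm (lin_comb b c z)"
      have m: "?m > 0" using z by (auto simp: prod_eq_iff max_def)
      then have dm: "0 < d * ?m" using d by simp
      have "?n \<le> \<bar>fst z\<bar> * norm b + \<bar>snd z\<bar> * norm c"
        unfolding lin_comb_def using norm_triangle_ineq by (metis norm_scaleR)
      also have "\<dots> \<le> 1 * norm b + 1 * norm c" using z1 by (intro add_mono mult_right_mono) auto
      finally have "?n \<le> ?R" by simp
      \<comment> \<open>\<open>K\<close> may be negative, so a bound on its absolute value needs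
        both an upper and a lower estimate.\<close>
      then have "K ?R \<le> K ?n" "K ?n \<le> K (d * ?m)"
        using dm d(3)[of z] by (auto intro!: kernel_le)
      then have "\<bar>K ?n\<bar> \<le> \<bar>K (d * ?m)\<bar> + \<bar>K ?R\<bar>" by linarith
      moreover have "\<bar>K (d * ?m)\<bar> \<le> ?f z + ?f (skew_swap 1 z)"
      proof (cases "\<bar>fst z\<bar> \<le> \<bar>snd z\<bar>")
        case True
        then have "snd z \<in> {-1..1}" "fst z \<in> {-\<bar>snd z\<bar>..\<bar>snd z\<bar>}" "?m = \<bar>snd z\<bar>"
          using z1 by auto
        then show ?thesis by (simp add: skew_swap_def case_prod_beta)
      next
        case False
        then have "fst z \<in> {-1..1}" "snd z \<in> {-\<bar>fst z\<bar>..\<bar>fst z\<bar>}" "?m = \<bar>fst z\<bar>"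
          using z1 by auto
        then show ?thesis by (simp add: skew_swap_def case_prod_beta)
      qed
      ultimately show ?thesis using True by simp linarith
    next
      case False
      then show ?thesis by simp
    qed
    then show "AE z in lborel. norm (?C z * K (norm (lin_comb b c z)))
       \<le> norm (?f z + ?f (skew_swap 1 z) + \<bar>K ?R\<bar> * ?C z)"
      using AE_lborel_singleton[of 0] by (rule eventually_mono[rotated])
  qed simp
  then show ?thesis by (simp add: set_integrable_def)
qed

text \<open>Both variables are replaced by simplex coordinates, each contributing a factor
  \<open>\<bar>det2 b c\<bar>\<close>; the vertex \<open>V\<close> cancels and the kernel depends on
  the difference of the coordinates alone.\<close>

lemma interaction_triangle:
  assumes d: "det2 b c \<noteq> 0"
  shows "interaction K (triangle_region V (V + b) (V + c))
    = (det2 b c)\<^sup>2 * (\<integral>z. K (norm (lin_comb b c z)) * covariogram z \<partial>lborel)"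
proof -
  let ?\<Omega> = "triangle_region V (V + b) (V + c)"
  let ?I = "indicator (corner 1) :: real \<times> real \<Rightarrow> real"
  let ?T = "lin_comb b c"
  have \<Omega>: "?\<Omega> = (\<lambda>z. V + ?T z) ` corner 1"
  proof -
    have "?\<Omega> = {V + ?T (u, v) |u v. (u, v) \<in> corner 1}"
      unfolding triangle_region_def convex_hull_3_alt by (simp add: corner_def lin_comb_def add.assoc)
    then show ?thesis by auto
  qed
  have inj: "inj ?T"
  proof (rule injI)
    fix x y assume "?T x = ?T y"
    then have "?T (x - y) = 0" by (simp add: lin_comb_diff)
    moreover obtain e where "0 < e" "e * max \<bar>fst (x - y)\<bar> \<bar>snd (x - y)\<bar> \<le> norm (?T (x - y))"
      using norm_lin_comb_ge[OF d] by blast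
    ultimately have "max \<bar>fst (x - y)\<bar> \<bar>snd (x - y)\<bar> \<le> 0"
      by (simp add: mult_le_0_iff)
    then have "x - y = 0" by (simp add: prod_eq_iff)
    then show "x = y" by simp
  qed
  have ind: "indicator ?\<Omega> (V + ?T z) = ?I z" for z
    using inj by (auto simp: \<Omega> indicator_def dest: injD)
  have "compact ?\<Omega>" unfolding triangle_region_def
    by (intro finite_imp_compact_convex_hull) auto
  then have [measurable]: "?\<Omega> \<in> sets borel" by (simp add: borel_compact)
  have inner: "(LINT y:?\<Omega>|lborel. K (norm (x - y)))
      = \<bar>det2 b c\<bar> * (\<integral>w. ?I w * K (norm (x - (V + ?T w))) \<partial>lborel)" for x
    unfolding set_lebesgue_integral_def
    by (subst integral_lin_comb[OF d, where V = V]) (auto simp: ind)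
  have "interaction K ?\<Omega>
      = \<bar>det2 b c\<bar> * (\<integral>z. ?I z * (\<bar>det2 b c\<bar> * (\<integral>w. ?I w * K (norm (V + ?T z - (V + ?T w))) \<partial>lborel)) \<partial>lborel)"
    unfolding interaction_def inner unfolding set_lebesgue_integral_def
    by (subst integral_lin_comb[OF d, where V = V]) (auto simp: ind)
  also have "\<dots> = \<bar>det2 b c\<bar> * (\<bar>det2 b c\<bar> * (\<integral>z. ?I z * (\<integral>w. ?I w * K (norm (?T (z - w))) \<partial>lborel) \<partial>lborel))"
    by (simp add: lin_comb_diff mult.left_commute)
  also have "\<dots> = (det2 b c)\<^sup>2 * (\<integral>z. K (norm (?T z)) * covariogram z \<partial>lborel)"
    using set_integrable_kernel_lin_comb[OF d]
    by (subst integral_corner_corner) (auto simp: power2_eq_square simp flip: mult.assoc)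
  finally show ?thesis .
qed

end

section \<open>Effect of a slide on the quadratic form and on the interaction integral\<close>

lemma norm_lin_comb_squared:
  fixes b c :: "'a::real_inner"
  shows "(norm (lin_comb b c z))\<^sup>2 = (fst z)\<^sup>2 * (norm b)\<^sup>2 + 2 * fst z * snd z * (b \<bullet> c) + (snd z)\<^sup>2 * (norm c)\<^sup>2"
  unfolding lin_comb_def power2_norm_eq_inner
  by (simp add: inner_simps inner_commute[of c b]) (simp add: power2_eq_square algebra_simps)

text \<open>The mixed term is unchanged, as the map keeps \<open>fst z * snd z\<close> and the
  rescaling keeps \<open>b \<bullet> c\<close>; the choice of \<open>\<rho>\<close> makes the two
  square terms change places.\<close>

lemma norm_lin_comb_skew_swap:
  fixes b c :: "'a::real_inner"
  assumes "\<mu> > 0" "b \<noteq> 0" "c \<noteq> 0"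
  shows "norm (lin_comb (b /\<^sub>R \<mu>) (\<mu> *\<^sub>R c) (skew_swap (\<mu> * norm c / norm b) z)) = norm (lin_comb b c z)"
proof (rule power2_eq_imp_eq)
  show "(norm (lin_comb (b /\<^sub>R \<mu>) (\<mu> *\<^sub>R c) (skew_swap (\<mu> * norm c / norm b) z)))\<^sup>2 = (norm (lin_comb b c z))\<^sup>2"
    using assms unfolding norm_lin_comb_squared
    by (simp add: skew_swap_def power_mult_distrib power_divide field_simps)
qed auto

text \<open>The mixed terms cancel, so the sign of the difference is decided by comparing
  \<open>\<bar>fst z\<bar>\<close> with \<open>\<rho> * \<bar>snd z\<bar>\<close>.\<close>

lemma norm_lin_comb_rescale:
  fixes b c :: "'a::real_inner"
  assumes "\<mu> > 0" "b \<noteq> 0" and \<rho>: "\<rho> = \<mu> * norm c / norm b"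
  shows "(norm (lin_comb (b /\<^sub>R \<mu>) (\<mu> *\<^sub>R c) z))\<^sup>2 - (norm (lin_comb b c z))\<^sup>2
    = (1 - \<mu>\<^sup>2) / \<mu>\<^sup>2 * (norm b)\<^sup>2 * ((fst z)\<^sup>2 - (\<rho> * snd z)\<^sup>2)"
proof -
  have nc: "norm c = \<rho> * norm b / \<mu>" using assms by simp
  show ?thesis
    using assms(1) unfolding norm_lin_comb_squared norm_scaleR nc by (simp add: field_simps power2_eq_square)
qed

context radial_kernel
begin

text \<open>The analytic core. The hypothesis \<open>norm b < \<mu> * norm c\<close> says exactly
  that \<open>\<rho> > 1\<close>.\<close>

lemma covariogram_integral_less:
  fixes b c :: "real ^ 2"
  assumes d: "det2 b c \<noteq> 0" and \<mu>: "0 < \<mu>" "\<mu> < 1" and bc: "norm b < \<mu> * norm c"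
  shows "(\<integral>z. K (norm (lin_comb b c z)) * covariogram z \<partial>lborel)
    < (\<integral>z. K (norm (lin_comb (b /\<^sub>R \<mu>) (\<mu> *\<^sub>R c) z)) * covariogram z \<partial>lborel)"
proof -
  define \<rho> where "\<rho> = \<mu> * norm c / norm b"
  have nz: "b \<noteq> 0" "c \<noteq> 0" using d by (auto simp: det2_def)
  have \<rho>: "\<rho> > 1" using bc nz by (simp add: \<rho>_def)
  have d': "det2 (b /\<^sub>R \<mu>) (\<mu> *\<^sub>R c) \<noteq> 0"
    using d \<mu> by (simp add: det2_def field_simps)
  let ?T = "lin_comb b c" and ?T' = "lin_comb (b /\<^sub>R \<mu>) (\<mu> *\<^sub>R c)" and ?\<tau> = "skew_swap \<rho>"
  define F where "F z = K (norm (?T' z)) - K (norm (?T z))" for z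
  have [measurable]: "F \<in> borel_measurable borel" unfolding F_def[abs_def] by measurable
  have \<tau>\<tau>: "?\<tau> (?\<tau> z) = z" for z using \<rho> by (simp add: skew_swap_skew_swap)
  have sw: "norm (?T' (?\<tau> z)) = norm (?T z)" for z
    unfolding \<rho>_def using \<mu> nz by (intro norm_lin_comb_skew_swap)
  have odd: "F (?\<tau> z) = - F z" for z
    using sw[of z] sw[of "?\<tau> z"] by (simp add: F_def \<tau>\<tau>)
  have Tpos: "norm (?T' z) > 0" if "z \<noteq> 0" for z
  proof -
    obtain e where "0 < e" "e * max \<bar>fst z\<bar> \<bar>snd z\<bar> \<le> norm (?T' z)"
      using norm_lin_comb_ge[OF d'] by blast
    moreover have "0 < max \<bar>fst z\<bar> \<bar>snd z\<bar>" using that by (auto simp: prod_eq_iff max_def)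
    ultimately show ?thesis by (smt (verit) mult_pos_pos)
  qed
  have cmp: "norm (?T' z) \<le> norm (?T z)" if "\<bar>fst z\<bar> \<le> \<rho> * \<bar>snd z\<bar>" for z
  proof -
    have "\<bar>fst z\<bar> \<le> \<bar>\<rho> * snd z\<bar>" using that \<rho> by (simp add: abs_mult)
    then have "(fst z)\<^sup>2 - (\<rho> * snd z)\<^sup>2 \<le> 0" by (simp add: abs_le_square_iff)
    moreover have "0 \<le> (1 - \<mu>\<^sup>2) / \<mu>\<^sup>2 * (norm b)\<^sup>2" using \<mu> by (simp add: power_le_one)
    ultimately have "(norm (?T' z))\<^sup>2 - (norm (?T z))\<^sup>2 \<le> 0"
      unfolding norm_lin_comb_rescale[OF \<mu>(1) nz(1) \<rho>_def] by (rule mult_nonneg_nonpos[rotated])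
    then have "(norm (?T' z))\<^sup>2 \<le> (norm (?T z))\<^sup>2" by simp
    then show ?thesis by (rule power2_le_imp_le) simp
  qed
  have cmp_strict: "norm (?T' z) < norm (?T z)" if "\<bar>fst z\<bar> < \<rho> * \<bar>snd z\<bar>" for z
  proof -
    have "\<bar>fst z\<bar> < \<bar>\<rho> * snd z\<bar>" using that \<rho> by (simp add: abs_mult)
    then have "(fst z)\<^sup>2 - (\<rho> * snd z)\<^sup>2 < 0" using abs_le_square_iff[of "\<rho> * snd z" "fst z"] by linarith
    moreover have "0 < (1 - \<mu>\<^sup>2) / \<mu>\<^sup>2 * (norm b)\<^sup>2" using \<mu> nz by (simp add: power_less_one_iff)
    ultimately have "(norm (?T' z))\<^sup>2 - (norm (?T z))\<^sup>2 < 0"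
      unfolding norm_lin_comb_rescale[OF \<mu>(1) nz(1) \<rho>_def] by (rule mult_pos_neg[rotated])
    then have "(norm (?T' z))\<^sup>2 < (norm (?T z))\<^sup>2" by simp
    then show ?thesis by (rule power2_less_imp_less) simp
  qed
  \<comment> \<open>At the origin both norms are 0 and \<open>F\<close> vanishes whatever
    \<open>K 0\<close> is.\<close>
  have F_nonneg: "0 \<le> F z" if "\<bar>fst z\<bar> \<le> \<rho> * \<bar>snd z\<bar>" for z
    using cmp[OF that] Tpos[of z] kernel_le by (cases "z = 0") (auto simp: F_def lin_comb_def)
  have g_mono: "covariogram (?\<tau> z) \<le> covariogram z" if "\<bar>fst z\<bar> \<le> \<rho> * \<bar>snd z\<bar>" for z
    unfolding covariogram_eq using \<rho> that by (intro measure_corner_mono) (simp add: gauge_skew_swap)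
  let ?G = "\<lambda>z. F z * (covariogram z - covariogram (?\<tau> z))"
  have G_nonneg: "0 \<le> ?G z" for z
  proof (cases "\<bar>fst z\<bar> \<le> \<rho> * \<bar>snd z\<bar>")
    case True
    then show ?thesis using F_nonneg g_mono by simp
  next
    case False
    \<comment> \<open>The involution carries \<open>z\<close> into the region already treated, and
      both factors of \<open>?G\<close> change sign under it.\<close>
    then have "\<bar>fst (?\<tau> z)\<bar> \<le> \<rho> * \<bar>snd (?\<tau> z)\<bar>"
      using \<rho> by (simp add: skew_swap_def abs_mult abs_divide)
    from F_nonneg[OF this] g_mono[OF this] show ?thesis
      by (simp add: odd \<tau>\<tau> mult_nonpos_nonpos)
  qed
  \<comment> \<open>On this rectangle \<open>fst z < snd z\<close>, so
    \<open>fst z < \<rho> * snd z\<close> for every \<open>\<rho> > 1\<close>, and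
    \<open>gauge z < 1\<close>, so the overlap of the simplices has positive area: both factors are
    strictly positive.\<close>
  define U where "U = {0<..<1 / 4 :: real} \<times> {1 / 4<..<1 / 2 :: real}"
  have G_pos: "0 < ?G z" if "z \<in> U" for z
  proof -
    have z: "0 < fst z" "0 < snd z" "fst z < snd z" "fst z + snd z < 1"
      using that by (auto simp: U_def)
    have "snd z < \<rho> * snd z" using z \<rho> by simp
    then have z': "fst z < \<rho> * snd z" using z by linarith
    have "gauge z < 1" using z by (simp add: gauge_def)
    then have "covariogram (?\<tau> z) < covariogram z"
      unfolding covariogram_eq using gauge_skew_swap_strict[OF \<rho> z(1,2) z']
      by (intro measure_corner_strict_mono) auto
    moreover have "0 < F z"
    proof -
      have "z \<noteq> 0" "\<bar>fst z\<bar> < \<rho> * \<bar>snd z\<bar>" using z z' by auto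
      then show ?thesis using kernel_less[OF Tpos cmp_strict] by (simp add: F_def)
    qed
    ultimately show ?thesis by simp
  qed
  have intT: "integrable lborel (\<lambda>z. K (norm (?T z)) * covariogram z)"
    "integrable lborel (\<lambda>z. K (norm (?T' z)) * covariogram z)"
    using set_integrable_kernel_lin_comb[OF d] set_integrable_kernel_lin_comb[OF d'] covariogram_bounds(1)
    by (auto intro!: integrable_mult_covariogram)
  then have intF: "integrable lborel (\<lambda>z. F z * covariogram z)"
    by (simp add: F_def left_diff_distrib)
  have dist: "distr lborel borel ?\<tau> = lborel" using \<rho> by (intro distr_skew_swap) simp
  have "integrable lborel (\<lambda>z. F (?\<tau> z) * covariogram (?\<tau> z))"
    using integrable_distr[of ?\<tau> lborel borel "\<lambda>z. F z * covariogram z"] intF by (simp add: dist)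
  then have intF': "integrable lborel (\<lambda>z. F z * covariogram (?\<tau> z))"
    by (simp add: odd)
  \<comment> \<open>Invariance of the measure together with oddness of \<open>F\<close> lets the
    integral be averaged with its image under the involution.\<close>
  have "(\<integral>z. F z * covariogram z \<partial>lborel) = (\<integral>z. F (?\<tau> z) * covariogram (?\<tau> z) \<partial>lborel)"
    using integral_distr[of ?\<tau> lborel borel "\<lambda>z. F z * covariogram z"] by (simp add: dist)
  also have "\<dots> = - (\<integral>z. F z * covariogram (?\<tau> z) \<partial>lborel)" by (simp add: odd)
  finally have "integral\<^sup>L lborel ?G = 2 * (\<integral>z. F z * covariogram z \<partial>lborel)"
    using intF intF' by (simp add: right_diff_distrib)
  moreover have "0 < integral\<^sup>L lborel ?G"
  proof -
    have intG: "integrable lborel ?G"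
      using intF intF' by (simp add: right_diff_distrib)
    have "integral\<^sup>L lborel ?G \<noteq> 0"
    proof
      assume "integral\<^sup>L lborel ?G = 0"
      then have "AE z in lborel. ?G z = 0"
        using integral_nonneg_eq_0_iff_AE[OF intG] G_nonneg by simp
      then have "AE z in lborel. z \<notin> U"
        by eventually_elim (use G_pos in force)
      moreover have "U \<in> sets lborel" by (simp add: U_def open_Times)
      ultimately have "emeasure lborel U = 0" by (simp add: AE_iff_measurable[OF _ refl])
      moreover have "emeasure lborel U = ennreal ((1 / 4 - 0) * (1 / 2 - 1 / 4))"
        unfolding U_def by (intro emeasure_lborel_rectangle) auto
      ultimately show False by simp
    qed
    moreover have "0 \<le> integral\<^sup>L lborel ?G" using G_nonneg by (intro integral_nonneg_AE) simp
    ultimately show ?thesis by simp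
  qed
  ultimately have "0 < (\<integral>z. F z * covariogram z \<partial>lborel)" by simp
  then show ?thesis using intT by (simp add: F_def left_diff_distrib)
qed

end

subsection \<open>Sliding the apex\<close>

lemma norm_squared_vec2: "(norm v)\<^sup>2 = (v $ 1)\<^sup>2 + (v $ 2)\<^sup>2" for v :: "real ^ 2"
  unfolding power2_norm_eq_inner by (simp add: inner_vec_def sum_2 power2_eq_square)

context radial_kernel
begin

text \<open>Sliding \<open>R\<close> to \<open>P + \<kappa> *\<^sub>R (R - P)\<close> multiplies the
  area by \<open>\<kappa>\<close>, and the dilation by \<open>1 / sqrt \<kappa>\<close> restores it;
  on edge vectors this is the rescaling with \<open>\<mu> = sqrt \<kappa>\<close>. The initial
  factor \<open>s\<close> permits slides to be composed.\<close>

lemma interaction_slide_vertex: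
  assumes s: "s > 0" and \<kappa>: "0 < \<kappa>" "\<kappa> < 1" and d: "det2 (Q - P) (R - P) \<noteq> 0"
    and le: "(norm (Q - P))\<^sup>2 < \<kappa> * (norm (R - P))\<^sup>2"
  defines "s' \<equiv> s / sqrt \<kappa>"
  shows "interaction K (triangle_region (s *\<^sub>R P) (s *\<^sub>R Q) (s *\<^sub>R R))
    < interaction K (triangle_region (s' *\<^sub>R P) (s' *\<^sub>R Q) (s' *\<^sub>R (P + \<kappa> *\<^sub>R (R - P))))"
proof -
  let ?b = "s *\<^sub>R (Q - P)" and ?c = "s *\<^sub>R (R - P)" and ?\<mu> = "sqrt \<kappa>"
  have \<mu>: "0 < ?\<mu>" "?\<mu> < 1" using \<kappa> by auto
  have det: "det2 (x *\<^sub>R u) (y *\<^sub>R v) = x * y * det2 u v" for x y u v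
    by (simp add: det2_def algebra_simps)
  have d1: "det2 ?b ?c \<noteq> 0" using d s by (simp add: det)
  have eq: "det2 (?b /\<^sub>R ?\<mu>) (?\<mu> *\<^sub>R ?c) = det2 ?b ?c"
    unfolding det[of "inverse ?\<mu>"] using \<mu> by simp
  have "norm (Q - P) < ?\<mu> * norm (R - P)"
  proof (rule power2_less_imp_less)
    show "(norm (Q - P))\<^sup>2 < (?\<mu> * norm (R - P))\<^sup>2" using le \<kappa> by (simp add: power_mult_distrib)
  qed (use \<mu> in auto)
  then have "norm ?b < ?\<mu> * norm ?c" using s by (simp add: mult.left_commute)
  from covariogram_integral_less[OF d1 \<mu> this]
  have "interaction K (triangle_region (s *\<^sub>R P) (s *\<^sub>R P + ?b) (s *\<^sub>R P + ?c))
      < interaction K (triangle_region (s' *\<^sub>R P) (s' *\<^sub>R P + ?b /\<^sub>R ?\<mu>) (s' *\<^sub>R P + ?\<mu> *\<^sub>R ?c))"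
    unfolding interaction_triangle[OF d1] interaction_triangle[OF d1[folded eq]] eq
    using d1 by simp
  moreover have "s' *\<^sub>R P + ?b /\<^sub>R ?\<mu> = s' *\<^sub>R Q"
    by (simp add: s'_def divide_inverse mult.commute algebra_simps)
  moreover have "s' *\<^sub>R P + ?\<mu> *\<^sub>R ?c = s' *\<^sub>R (P + \<kappa> *\<^sub>R (R - P))"
  proof -
    have "s' * \<kappa> = ?\<mu> * s" using \<kappa> by (simp add: s'_def real_div_sqrt field_simps)
    then show ?thesis by (simp add: scaleR_add_right)
  qed
  moreover have "s *\<^sub>R P + ?b = s *\<^sub>R Q" "s *\<^sub>R P + ?c = s *\<^sub>R R"
    by (simp_all add: scaleR_diff_right)
  ultimately show ?thesis by (simp only:)
qed

text \<open>\<open>X\<close> slides towards \<open>A\<close> to a point \<open>Z\<close>, then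
  \<open>Z\<close> slides towards \<open>B\<close> to \<open>Y\<close>. \<open>A\<close> is the
  endpoint farther from the foot of the altitude, \<open>\<epsilon>\<close> records its side, and
  the last condition on \<open>h'\<close> says that \<open>B Y\<close> is longer than
  \<open>A B\<close>.\<close>

lemma interaction_lower_apex:
  fixes A B X Y :: "real ^ 2"
  assumes AB: "A $ 1 = - \<epsilon> * \<alpha>" "B $ 1 = \<epsilon> * \<beta>" "A $ 2 = 0" "B $ 2 = 0" "\<bar>\<epsilon>\<bar> = 1"
    and X: "X $ 1 = 0" "X $ 2 = h" and Y: "Y $ 1 = 0" "Y $ 2 = h'"
    and \<alpha>\<beta>: "0 \<le> \<beta>" "\<beta> \<le> \<alpha>" "0 < \<alpha>" and h: "0 < h'" "h' < h" "(\<alpha> + \<beta>)\<^sup>2 < \<beta>\<^sup>2 + h'\<^sup>2"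
    and s: "0 < s"
  defines "s' \<equiv> s / sqrt (h' / h)"
  shows "interaction K (triangle_region (s *\<^sub>R A) (s *\<^sub>R B) (s *\<^sub>R X))
    < interaction K (triangle_region (s' *\<^sub>R A) (s' *\<^sub>R B) (s' *\<^sub>R Y))"
proof -
  define l where "l = \<alpha> + \<beta>"
  define k where "k = \<alpha> * h' + \<beta> * h"
  \<comment> \<open>This ratio puts \<open>Z\<close> on the intersection of the lines
    \<open>A X\<close> and \<open>B Y\<close>. Then \<open>\<nu>\<close> is the ratio of the heights
    of \<open>Y\<close> and \<open>Z\<close>, so \<open>\<kappa> * \<nu> = h' / h\<close>.\<close>
  define \<kappa> where "\<kappa> = l * h' / k"
  define \<nu> where "\<nu> = k / (l * h)"
  define Z where "Z = A + \<kappa> *\<^sub>R (X - A)"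
  define s1 where "s1 = s / sqrt \<kappa>"
  have \<epsilon>: "\<epsilon> \<noteq> 0" "\<epsilon>\<^sup>2 = 1" using AB(5) by (auto simp: power2_eq_1_iff abs_if split: if_splits)
  have pos: "0 < h" "0 < l" "0 < k" using \<alpha>\<beta> h by (auto simp: l_def k_def intro: add_pos_nonneg)
  then have \<kappa>\<nu>: "0 < \<kappa>" "0 < \<nu>" "\<kappa> * \<nu> = h' / h"
    using h by (auto simp: \<kappa>_def \<nu>_def)
  have "\<alpha> * h' < \<alpha> * h" using \<alpha>\<beta> h by simp
  then have \<nu>1: "\<nu> < 1" using pos by (simp add: \<nu>_def l_def k_def algebra_simps)
  have s1: "0 < s1" using s \<kappa>\<nu> by (simp add: s1_def)
  have BA: "(norm (B - A))\<^sup>2 = l\<^sup>2" "(norm (A - B))\<^sup>2 = l\<^sup>2"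
    using AB \<epsilon> by (simp_all add: norm_squared_vec2 l_def) (simp_all add: power2_eq_square algebra_simps)
  have hh: "\<alpha>\<^sup>2 + 2 * \<alpha> * \<beta> < h'\<^sup>2" using h(3) by (simp add: power2_eq_square algebra_simps)
  have Z: "Z $ 1 = - \<epsilon> * \<alpha> * (1 - \<kappa>)" "Z $ 2 = \<kappa> * h"
    using AB X by (auto simp: Z_def algebra_simps)
  have step1: "interaction K (triangle_region (s *\<^sub>R A) (s *\<^sub>R B) (s *\<^sub>R X))
    \<le> interaction K (triangle_region (s1 *\<^sub>R A) (s1 *\<^sub>R B) (s1 *\<^sub>R Z))"
  proof (cases "\<beta> = 0")
    case True
    \<comment> \<open>With \<open>B\<close> at the foot of the altitude the lowering is already a
      slide towards \<open>B\<close>; the first slide is trivial, hence only a weak inequality in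
      this step.\<close>
    then have "\<kappa> = 1" using pos \<alpha>\<beta> h by (simp add: \<kappa>_def l_def k_def)
    then show ?thesis by (simp add: s1_def Z_def)
  next
    case False
    then have "\<beta> * h' < \<beta> * h" using \<alpha>\<beta> h by simp
    then have "\<kappa> < 1" using pos by (simp add: \<kappa>_def l_def k_def algebra_simps)
    have XA: "(norm (X - A))\<^sup>2 = \<alpha>\<^sup>2 + h\<^sup>2"
      using AB X \<epsilon> by (simp add: norm_squared_vec2 power_mult_distrib)
    \<comment> \<open>This is the slide condition at \<open>A\<close> with denominators cleared; it
      follows from \<open>hh\<close>, \<open>\<beta> \<le> \<alpha>\<close> and
      \<open>h' < h\<close>.\<close>
    have "l * k < h' * (\<alpha>\<^sup>2 + h\<^sup>2)"
    proof -
      have "\<beta> * \<beta> \<le> \<alpha> * \<alpha>" using \<alpha>\<beta> by (intro mult_mono) auto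
      then have "(\<alpha> * \<beta> + \<alpha> * \<beta> + \<beta> * \<beta>) * h \<le> (\<alpha>\<^sup>2 + 2 * \<alpha> * \<beta>) * h"
        using pos by (intro mult_right_mono) (auto simp: power2_eq_square)
      also have "\<dots> < h'\<^sup>2 * h" using hh pos by simp
      also have "\<dots> \<le> (h' * h) * h" using h pos by (simp add: power2_eq_square)
      finally have "(\<alpha> * \<beta> + \<alpha> * \<beta> + \<beta> * \<beta>) * h < h' * h * h" .
      moreover have "\<alpha> * \<beta> * h' \<le> \<alpha> * \<beta> * h" using \<alpha>\<beta> h by (intro mult_left_mono) auto
      ultimately show ?thesis by (simp add: l_def k_def power2_eq_square algebra_simps)
    qed
    then have "l * (l * k) < l * (h' * (\<alpha>\<^sup>2 + h\<^sup>2))" using pos by simp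
    then have "(norm (B - A))\<^sup>2 < \<kappa> * (norm (X - A))\<^sup>2"
      unfolding BA XA using pos by (simp add: \<kappa>_def field_simps power2_eq_square)
    moreover have "det2 (B - A) (X - A) \<noteq> 0"
    proof -
      have "det2 (B - A) (X - A) = \<epsilon> * l * h" using AB X by (simp add: det2_def l_def algebra_simps)
      then show ?thesis using \<epsilon> pos by simp
    qed
    ultimately show ?thesis
      using interaction_slide_vertex[OF s \<kappa>\<nu>(1) \<open>\<kappa> < 1\<close>, of B A X] by (simp add: Z_def s1_def)
  qed
  have Yeq: "B + \<nu> *\<^sub>R (Z - B) = Y"
  proof -
    have "\<kappa> * \<nu> * h = h'" using \<kappa>\<nu> pos by simp
    then have y2: "\<nu> * (\<kappa> * h) = h'" by (simp add: mult_ac)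
    have "\<alpha> * (\<kappa> * \<nu>) + \<beta> - \<nu> * l = 0"
      unfolding \<kappa>\<nu>(3) using pos by (simp add: \<nu>_def k_def field_simps)
    then have "\<epsilon> * (\<alpha> * (\<kappa> * \<nu>) + \<beta> - \<nu> * l) = 0" by simp
    then have "B $ 1 + \<nu> * (Z $ 1 - B $ 1) = 0"
      unfolding Z AB l_def by (simp add: algebra_simps)
    then show ?thesis using y2 AB Y Z by (simp add: vec_eq_iff forall_2)
  qed
  \<comment> \<open>Since \<open>\<nu> *\<^sub>R (Z - B) = Y - B\<close>, multiplying by
    \<open>\<nu> < 1\<close> reduces the slide condition at \<open>B\<close> to the hypothesis that
    \<open>B Y\<close> exceeds \<open>A B\<close>.\<close>
  have "(norm (A - B))\<^sup>2 < \<nu> * (norm (Z - B))\<^sup>2"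
  proof -
    have "\<nu> *\<^sub>R (Z - B) = Y - B" using Yeq by (simp add: algebra_simps)
    then have "\<nu> * norm (Z - B) = norm (Y - B)" using \<kappa>\<nu> by (metis abs_of_pos norm_scaleR)
    then have "\<nu>\<^sup>2 * (norm (Z - B))\<^sup>2 = (norm (Y - B))\<^sup>2"
      by (simp flip: power_mult_distrib)
    also have "\<dots> = \<beta>\<^sup>2 + h'\<^sup>2"
      using AB Y \<epsilon> by (simp add: norm_squared_vec2 power_mult_distrib)
    finally have *: "\<nu>\<^sup>2 * (norm (Z - B))\<^sup>2 = \<beta>\<^sup>2 + h'\<^sup>2" .
    have "\<nu> * l\<^sup>2 < \<nu> * (\<nu> * (norm (Z - B))\<^sup>2)"
    proof -
      have "\<nu> * l\<^sup>2 \<le> 1 * l\<^sup>2" using \<nu>1 by (intro mult_right_mono) auto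
      also have "\<dots> < \<beta>\<^sup>2 + h'\<^sup>2" using h by (simp add: l_def)
      also have "\<dots> = \<nu> * (\<nu> * (norm (Z - B))\<^sup>2)"
        using * by (simp add: power2_eq_square mult.assoc)
      finally show ?thesis .
    qed
    then show ?thesis using \<kappa>\<nu> BA by simp
  qed
  moreover have "det2 (A - B) (Z - B) \<noteq> 0"
  proof -
    have "det2 (A - B) (Z - B) = - \<epsilon> * l * (\<kappa> * h)" using AB Z by (simp add: det2_def l_def algebra_simps)
    then show ?thesis using \<epsilon> pos \<kappa>\<nu> by simp
  qed
  moreover have "s1 / sqrt \<nu> = s'"
    using \<kappa>\<nu> by (simp add: s1_def s'_def flip: real_sqrt_mult \<kappa>\<nu>(3))
  ultimately have "interaction K (triangle_region (s1 *\<^sub>R B) (s1 *\<^sub>R A) (s1 *\<^sub>R Z))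
    < interaction K (triangle_region (s' *\<^sub>R B) (s' *\<^sub>R A) (s' *\<^sub>R Y))"
    using interaction_slide_vertex[OF s1 \<kappa>\<nu>(2) \<nu>1, of A B Z] by (simp add: Yeq)
  with step1 show ?thesis by (simp add: triangle_region_def insert_commute)
qed

end

section \<open>The flow of triangles in coordinates and its monotonicity\<close>

lemma vertex_angle_le_pi_half_iff:
  assumes "P \<noteq> Q" "R \<noteq> Q"
  shows "vertex_angle P Q R \<le> pi / 2 \<longleftrightarrow> 0 \<le> (P - Q) \<bullet> (R - Q)"
proof -
  let ?x = "((P - Q) \<bullet> (R - Q)) / (norm (P - Q) * norm (R - Q))"
  have n: "norm (P - Q) * norm (R - Q) > 0" using assms by simp
  have "\<bar>?x\<bar> \<le> 1" using Cauchy_Schwarz_ineq2[of "P - Q" "R - Q"] n by (simp add: abs_mult)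
  then have "arccos ?x \<le> arccos 0 \<longleftrightarrow> 0 \<le> ?x" by (intro arccos_le_mono) auto
  also have "0 \<le> ?x \<longleftrightarrow> 0 \<le> (P - Q) \<bullet> (R - Q)" using n by (simp add: zero_le_divide_iff)
  finally show ?thesis by (simp add: vertex_angle_def)
qed

lemma triangle_flow_eq:
  assumes "C $ 1 = 0" "0 < C $ 2" "t < 1"
  shows "triangle_flow A B C t = triangle_region (sqrt (1 / (1 - t)) *\<^sub>R A) (sqrt (1 / (1 - t)) *\<^sub>R B)
    (sqrt (1 / (1 - t)) *\<^sub>R apex C t)"
proof -
  have "C \<noteq> 0" using assms by auto
  then have "dist 0 C / dist 0 (apex C t) = 1 / (1 - t)" using assms by (simp add: apex_def)
  then show ?thesis
    unfolding triangle_flow_def triangle_region_def by (simp flip: convex_hull_scaling)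
qed

theorem theorem1p3:
  fixes K :: "real \<Rightarrow> real" and A B C :: "real ^ 2"
  assumes K_C1: "K C1_differentiable_on {0<..}"
    and K_decreasing: "strict_antimono_on {0<..} K"
    and K_integrable: "set_integrable lborel {0<..<1} (\<lambda>r. K r * r)"
    and triangle: "non_obtuse_triangle A B C"
    and AB_on_x_axis: "A $ 2 = 0" "B $ 2 = 0"
    and C_on_y_axis: "C $ 1 = 0" "C $ 2 > 0"
    and sides: "dist A B < dist B C" "dist B C \<le> dist A C"
  shows "(\<exists>!t\<^sub>2. t\<^sub>2 \<in> {0<..<1} \<and> dist B A = dist B (apex C t\<^sub>2)) \<and>
    (\<forall>t\<^sub>2. t\<^sub>2 \<in> {0<..<1} \<and> dist B A = dist B (apex C t\<^sub>2) \<longrightarrow>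
       strict_mono_on {..<t\<^sub>2} (\<lambda>t. interaction K (triangle_flow A B C t)))"
proof -
  define a b c where "a = A $ 1" "b = B $ 1" "c = C $ 2"
  note abc = a_b_c_def
  have dist_sq: "(dist x y)\<^sup>2 = (x $ 1 - y $ 1)\<^sup>2 + (x $ 2 - y $ 2)\<^sup>2" for x y :: "real ^ 2"
    by (simp add: dist_norm norm_squared_vec2)
  have c: "0 < c" using C_on_y_axis by (simp add: abc)
  have "A \<noteq> B" using triangle by (auto simp: non_obtuse_triangle_def)
  then have ab: "a \<noteq> b" using AB_on_x_axis by (auto simp: abc vec_eq_iff forall_2)
  have "A \<noteq> C" "B \<noteq> C" using AB_on_x_axis C_on_y_axis by auto
  then have "0 \<le> (B - A) \<bullet> (C - A)" "0 \<le> (A - B) \<bullet> (C - B)"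
    using triangle \<open>A \<noteq> B\<close> vertex_angle_le_pi_half_iff[of B A C] vertex_angle_le_pi_half_iff[of A B C]
    by (auto simp: non_obtuse_triangle_def)
  \<comment> \<open>The angle conditions at \<open>A\<close> and \<open>B\<close> mean that the
    origin, the foot of the altitude from \<open>C\<close>, lies on the segment
    \<open>A B\<close>.\<close>
  then have ang: "0 \<le> (b - a) * (- a)" "0 \<le> (a - b) * (- b)"
    using AB_on_x_axis C_on_y_axis by (auto simp: inner_vec_def sum_2 abc)
  have sq: "\<And>x y z w :: real ^ 2. dist x y \<le> dist z w \<longleftrightarrow> (dist x y)\<^sup>2 \<le> (dist z w)\<^sup>2"
    by (simp add: abs_le_square_iff[symmetric])
  have "b\<^sup>2 \<le> a\<^sup>2" using sides(2) AB_on_x_axis C_on_y_axis unfolding sq dist_sq by (simp add: abc)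
  then have ba: "\<bar>b\<bar> \<le> \<bar>a\<bar>" by (simp add: abs_le_square_iff)
  define \<alpha> \<beta> where "\<alpha> = \<bar>a\<bar>" "\<beta> = \<bar>b\<bar>"
  note \<alpha>\<beta>_def = \<alpha>_\<beta>_def
  \<comment> \<open>The sign treats both orientations of the base at once: 1 if \<open>A\<close> is
    on the left, -1 if it is on the right.\<close>
  obtain \<epsilon> :: real where \<epsilon>: "\<bar>\<epsilon>\<bar> = 1" "a = - \<epsilon> * \<alpha>" "b = \<epsilon> * \<beta>"
  proof (cases "a < b")
    case True
    then have "a \<le> 0" "0 \<le> b" using ang by (auto simp: zero_le_mult_iff mult_le_0_iff)
    then show ?thesis by (intro that[of 1]) (auto simp: \<alpha>\<beta>_def)
  next
    case False
    then have "0 \<le> a" "b \<le> 0" using ang ab by (auto simp: zero_le_mult_iff mult_le_0_iff)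
    then show ?thesis by (intro that[of "-1"]) (auto simp: \<alpha>\<beta>_def)
  qed
  have \<alpha>\<beta>: "0 \<le> \<beta>" "\<beta> \<le> \<alpha>" "0 < \<alpha>" using ba ab by (auto simp: \<alpha>\<beta>_def)
  have \<epsilon>2: "\<epsilon>\<^sup>2 = 1" using \<epsilon>(1) by (auto simp: power2_eq_1_iff abs_if split: if_splits)
  have dBA: "(dist B A)\<^sup>2 = (\<alpha> + \<beta>)\<^sup>2"
  proof -
    have "(dist B A)\<^sup>2 = (\<epsilon> * (\<alpha> + \<beta>))\<^sup>2"
      using \<epsilon> AB_on_x_axis by (simp add: dist_sq abc algebra_simps)
    then show ?thesis by (simp add: power_mult_distrib \<epsilon>2)
  qed
  have dBC: "(dist B (apex C t))\<^sup>2 = \<beta>\<^sup>2 + ((1 - t) * c)\<^sup>2" for t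
    using AB_on_x_axis C_on_y_axis by (simp add: dist_sq apex_def \<alpha>\<beta>_def abc)
  have t2_iff: "dist B A = dist B (apex C t) \<longleftrightarrow> (\<alpha> + \<beta>)\<^sup>2 = \<beta>\<^sup>2 + ((1 - t) * c)\<^sup>2" for t
    unfolding dBA[symmetric] dBC[symmetric] by (simp add: power2_eq_iff_nonneg)
  \<comment> \<open>The apex height at which the side from \<open>B\<close> is as long as the
    base.\<close>
  define q where "q = sqrt ((\<alpha> + \<beta>)\<^sup>2 - \<beta>\<^sup>2)"
  have q0: "0 < (\<alpha> + \<beta>)\<^sup>2 - \<beta>\<^sup>2" using \<alpha>\<beta> by (simp add: power2_eq_square algebra_simps add_pos_nonneg)
  have q: "0 < q" "q\<^sup>2 = (\<alpha> + \<beta>)\<^sup>2 - \<beta>\<^sup>2" using q0 by (auto simp: q_def)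
  \<comment> \<open>As \<open>apex C 0 = C\<close>, the strict side inequality places the critical
    height \<open>q\<close> below \<open>c\<close>, hence the critical time inside
    \<open>(0, 1)\<close>.\<close>
  have "(dist B A)\<^sup>2 < (dist B (apex C 0))\<^sup>2"
    using sides(1) by (simp add: apex_def dist_commute power_strict_mono)
  then have "q\<^sup>2 < c\<^sup>2" unfolding dBA dBC q by simp
  then have qc: "q < c" using c by (simp add: power2_less_imp_less)
  have t2_iff': "t \<in> {0<..<1} \<and> dist B A = dist B (apex C t) \<longleftrightarrow> t = 1 - q / c" for t
  proof
    assume t: "t \<in> {0<..<1} \<and> dist B A = dist B (apex C t)"
    then have "q\<^sup>2 = ((1 - t) * c)\<^sup>2" by (simp add: t2_iff q)
    then have "q = (1 - t) * c" using t q c by (simp add: power2_eq_iff_nonneg)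
    then show "t = 1 - q / c" using c by (simp add: field_simps)
  next
    assume t: "t = 1 - q / c"
    then have "(1 - t) * c = q" using c by simp
    then show "t \<in> {0<..<1} \<and> dist B A = dist B (apex C t)"
      using t q qc c by (simp add: t2_iff)
  qed
  \<comment> \<open>The hypotheses do not make \<open>K\<close> measurable on the negative reals.\<close>
  define K' where "K' r = (if r \<in> {0<..} then K r else 0) + K 0 * indicator {0} r" for r
  have K': "K' r = K r" if "0 \<le> r" for r using that by (auto simp: K'_def)
  interpret K': radial_kernel K'
  proof
    have "continuous_on {0<..} K" using K_C1 by (rule C1_differentiable_imp_continuous_on)
    then have "(\<lambda>r. if r \<in> {0<..} then K r else 0) \<in> borel_measurable borel"
      by (intro borel_measurable_continuous_on_if) auto
    then show "K' \<in> borel_measurable borel" unfolding K'_def[abs_def] by measurable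
    show "strict_antimono_on {0<..} K'"
      using K_decreasing K' by (auto simp: monotone_on_def)
    have "(\<lambda>r. indicator {0<..<1} r *\<^sub>R (K' r * r)) = (\<lambda>r. indicator {0<..<1} r *\<^sub>R (K r * r))"
      using K' by (auto simp: indicator_def)
    then show "set_integrable lborel {0<..<1} (\<lambda>r. K' r * r)"
      using K_integrable by (simp add: set_integrable_def)
  qed
  \<comment> \<open>The kernels agree at every nonnegative argument, including 0, and norms take no
    other values.\<close>
  have int: "interaction K S = interaction K' S" for S
    unfolding interaction_def by (simp add: K')
  have "strict_mono_on {..<1 - q / c} (\<lambda>t. interaction K (triangle_flow A B C t))"
  proof (rule strict_mono_onI)
    fix t u assume tu: "t \<in> {..<1 - q / c}" "u \<in> {..<1 - q / c}" "t < u"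
    have "q / c < 1 - u" using tu by simp
    then have h: "q < (1 - u) * c" using c by (simp add: field_simps)
    have "0 < q / c" using q c by simp
    then have lt: "t < 1" "u < 1" using tu by auto
    \<comment> \<open>The length condition concerns the lower of the two apices, the one at the
      later time \<open>u\<close>.\<close>
    have "(\<alpha> + \<beta>)\<^sup>2 < \<beta>\<^sup>2 + ((1 - u) * c)\<^sup>2"
      using power_strict_mono[OF h, of 2] q by simp
    moreover have "(1 - u) * c < (1 - t) * c" using tu c by simp
    \<comment> \<open>The dilation factor produced by the lowering from time \<open>t\<close> is the
      factor of the flow at time \<open>u\<close>.\<close>
    moreover have "sqrt (1 / (1 - t)) / sqrt ((1 - u) * c / ((1 - t) * c)) = sqrt (1 / (1 - u))"
      using lt c by (simp add: real_sqrt_divide)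
    ultimately show "interaction K (triangle_flow A B C t) < interaction K (triangle_flow A B C u)"
      using K'.interaction_lower_apex[of A \<epsilon> \<alpha> B \<beta> "apex C t" "(1 - t) * c" "apex C u" "(1 - u) * c"
          "sqrt (1 / (1 - t))"] \<epsilon> \<alpha>\<beta> h q lt AB_on_x_axis C_on_y_axis
      by (simp add: int triangle_flow_eq abc apex_def)
  qed
  then show ?thesis unfolding t2_iff' by auto
qed

end
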